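(* Let $d\ge1$. Up to isomorphism of the removed complex $\Diamond(\Gamma)$, there are exactly $2^{d+1}-1$ combinatorially different basic cross-flips in dimension $d$; that is, among the complexes $\Diamond(\Gamma)$, where $\Gamma$ ranges over the $d$-balls $\Gamma\subsetneq\partial\sigma^{d+1}$ that are pure $d$-dimensional subcomplexes, there are exactly $2^{d+1}-1$ isomorphism classes.
   Context: $\sigma^{d+1}$ is the simplex on $\{0,\dots,d+1\}$. For a pure $d$-dimensional subcomplex $\Gamma\subseteq\partial\sigma^{d+1}$, $\Diamond(\Gamma)$ is obtained by, for $i=0,1,\dots,d$ in this order, stellarly subdividing the current complex $K$ at $F_i=\{i+1,\dots,d+1\}$ whenever $F_i\in K$, i.e. replacing $K$ by $(K\setminus F_i)\cup(\langle v_i\rangle*\partial F_i*\mathrm{lk}_K(F_i))$ with new vertex $v_i$. $\Diamond(\Gamma)$ is a subcomplex of the boundary $\mathcal{C}_d$ of the $(d+1)$-dimensional cross-polytope on $\{0,\dots,d\}\cup\{v_0,\dots,v_d\}$. A basic cross-flip $\chi^*_{\Diamond(\Gamma)}$ ($\Gamma\subsetneq\partial\sigma^{d+1}$ a $d$-ball) replaces, in a balanced $d$-complex $\Delta$, an induced subcomplex $D\cong\Diamond(\Gamma)$ by $\mathcal{C}_d\setminus D$ (the complex generated by the facets of $\mathcal{C}_d$ not in $D$): $\chi^*_D(\Delta)=(\Delta\setminus D)\cup(\mathcal{C}_d\setminus D)$. Two basic cross-flips are combinatorially the same when the complexes $\Diamond(\Gamma)$ they remove are isomorphic. *)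

theory Defs
  imports "HOL-Analysis.Analysis"
begin

(* An abstract simplicial complex is given by its set of faces, the empty face included. *)

type_synonym 'v complex = "'v set set"

definition simplicial_complex :: "'v complex \<Rightarrow> bool" where
  "simplicial_complex K \<longleftrightarrow> (\<forall>\<sigma>\<in>K. finite \<sigma> \<and> (\<forall>\<tau>. \<tau> \<subseteq> \<sigma> \<longrightarrow> \<tau> \<in> K))"

(* A face of dimension d has d + 1 vertices.  Only nonempty complexes are pure of dimension d. *)
definition pure_dim :: "nat \<Rightarrow> 'v complex \<Rightarrow> bool" where
  "pure_dim d K \<longleftrightarrow> K \<noteq> {} \<and> (\<forall>\<sigma>\<in>K. card \<sigma> \<le> d + 1 \<and> (\<exists>\<tau>\<in>K. \<sigma> \<subseteq> \<tau> \<and> card \<tau> = d + 1))"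

definition full_simplex :: "'v set \<Rightarrow> 'v complex" where
  "full_simplex \<sigma> = Pow \<sigma>"

definition simplex_boundary :: "'v set \<Rightarrow> 'v complex" where
  "simplex_boundary \<sigma> = full_simplex \<sigma> - {\<sigma>}"

definition link :: "'v complex \<Rightarrow> 'v set \<Rightarrow> 'v complex" where
  "link K \<sigma> = {\<tau> \<in> K. \<sigma> \<inter> \<tau> = {} \<and> \<sigma> \<union> \<tau> \<in> K}"

definition deletion :: "'v complex \<Rightarrow> 'v set \<Rightarrow> 'v complex" where
  "deletion K \<sigma> = {\<tau> \<in> K. \<not> \<sigma> \<subseteq> \<tau>}"

(* Only applied to complexes on disjoint vertex sets. *)
definition join :: "'v complex \<Rightarrow> 'v complex \<Rightarrow> 'v complex" where
  "join K L = {\<sigma> \<union> \<tau> | \<sigma> \<tau>. \<sigma> \<in> K \<and> \<tau> \<in> L}"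

definition stellar_subdivision :: "'v complex \<Rightarrow> 'v set \<Rightarrow> 'v \<Rightarrow> 'v complex" where
  "stellar_subdivision K \<sigma> v =
     deletion K \<sigma> \<union> join (full_simplex {v}) (join (simplex_boundary \<sigma>) (link K \<sigma>))"

definition isomorphic_complexes :: "'v complex \<Rightarrow> 'w complex \<Rightarrow> bool" where
  "isomorphic_complexes K L \<longleftrightarrow> (\<exists>f. bij_betw f (\<Union>K) (\<Union>L) \<and> (\<lambda>\<sigma>. f ` \<sigma>) ` K = L)"

(* Points are barycentric coordinate functions.  The product topology induces the usual
   topology of the realization when the complex is finite, as all complexes below are. *)
definition realization :: "'v complex \<Rightarrow> ('v \<Rightarrow> real) topology" where
  "realization K = subtopology (powertop_real UNIV)
     {x. \<exists>\<sigma>\<in>K. (\<forall>v. 0 \<le> x v) \<and> (\<forall>v. v \<notin> \<sigma> \<longrightarrow> x v = 0) \<and> sum x \<sigma> = 1}"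

definition closed_ball :: "nat \<Rightarrow> (nat \<Rightarrow> real) topology" where
  "closed_ball d = subtopology (Euclidean_space d) {x. (\<Sum>i<d. (x i)\<^sup>2) \<le> 1}"

definition simplicial_ball :: "nat \<Rightarrow> 'v complex \<Rightarrow> bool" where
  "simplicial_ball d K \<longleftrightarrow>
     simplicial_complex K \<and> finite K \<and> realization K homeomorphic_space closed_ball d"

(* Old i is the vertex i of the simplex on {0, ..., d + 1}; New i is the subdivision vertex v_i. *)
datatype vertex = Old nat | New nat

definition boundary_sigma :: "nat \<Rightarrow> vertex complex" where
  "boundary_sigma d = simplex_boundary (Old ` {0..d+1})"

definition diamond_face :: "nat \<Rightarrow> nat \<Rightarrow> vertex set" where
  "diamond_face d i = Old ` {i+1..d+1}"

definition diamond_step :: "nat \<Rightarrow> nat \<Rightarrow> vertex complex \<Rightarrow> vertex complex" where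
  "diamond_step d i K =
     (if diamond_face d i \<in> K then stellar_subdivision K (diamond_face d i) (New i) else K)"

(* The steps are performed in the order i = 0, 1, ..., d. *)
definition diamond :: "nat \<Rightarrow> vertex complex \<Rightarrow> vertex complex" where
  "diamond d \<Gamma> = fold (diamond_step d) [0..<d+1] \<Gamma>"

(* The balls that index the basic cross-flips in dimension d. *)
definition flip_balls :: "nat \<Rightarrow> vertex complex set" where
  "flip_balls d = {\<Gamma>. simplicial_complex \<Gamma> \<and> \<Gamma> \<subset> boundary_sigma d \<and> pure_dim d \<Gamma> \<and> simplicial_ball d \<Gamma>}"

(* A basic cross-flip replaces an induced copy of D = diamond d \<Gamma> in a balanced d-complex by the
   complement of D in the cross-polytope boundary.  Basic cross-flips are compared only through the
   complexes D that they remove. *)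
definition removed_complexes :: "nat \<Rightarrow> vertex complex set" where
  "removed_complexes d = diamond d ` flip_balls d"

definition same_flip :: "nat \<Rightarrow> vertex complex rel" where
  "same_flip d = {(D, E). D \<in> removed_complexes d \<and> E \<in> removed_complexes d \<and> isomorphic_complexes D E}"

end

theory Submission
  imports Defs "HOL-Library.Nat_Bijection"
begin

text \<open>A pure \<open>d\<close>-dimensional proper subcomplex of the boundary of the simplex is determined by the
  nonempty proper set \<open>T\<close> of vertices \<open>t\<close> whose opposite facet it contains, and it is a ball.
  Facets of the cross-polytope correspond to sets \<open>N \<subseteq> {..d}\<close>, where \<open>n \<in> N\<close> means that \<open>v\<^sub>n\<close>
  is chosen from the pair \<open>n, v\<^sub>n\<close>. The facet opposite to \<open>t\<close> is subdivided into those with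
  \<open>Min N = t\<close>, or \<open>N = {}\<close> in case \<open>t = d + 1\<close>. If \<open>d + 1 \<notin> T\<close>, the diamond therefore
  has \<open>\<Sum>t\<in>T. 2 ^ (d - t)\<close> facets, and by uniqueness of binary expansions these complexes are
  pairwise non-isomorphic. If \<open>d + 1 \<in> T\<close>, exchanging one pair of antipodal vertices produces the
  diamond of a set not containing \<open>d + 1\<close>. So the classes correspond to the nonempty subsets of
  \<open>{..d}\<close>.\<close>

section \<open>Subcomplexes of the boundary of a simplex\<close>

text \<open>For \<open>T\<close> \<subseteq> \<open>V\<close> this is the join of the boundary of
  the simplex \<open>T\<close> with the full simplex on \<open>V - T\<close>, the complex generated
  by the facets opposite to the vertices in \<open>T\<close>.\<close>

definition omitting :: "'v set \<Rightarrow> 'v set \<Rightarrow> 'v complex" where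
  "omitting V T = {\<sigma>. \<sigma> \<subseteq> V \<and> \<not> T \<subseteq> \<sigma>}"

text \<open>A face with \<open>d + 1\<close> of the \<open>d + 2\<close> vertices misses exactly one
  of them, so purity places each face in some \<open>V - {v}\<close> belonging to \<open>K\<close>.
  Closure under subsets gives the converse inclusion.\<close>

lemma pure_subcomplex_boundary:
  assumes K: "simplicial_complex K" and sub: "K \<subseteq> simplex_boundary V" and pure: "pure_dim d K"
    and V: "finite V" "card V = d + 2"
  defines "T \<equiv> {v \<in> V. V - {v} \<in> K}"
  shows "K = omitting V T" and "T \<noteq> {}"
proof -
  have KV: "\<sigma> \<subset> V" if "\<sigma> \<in> K" for \<sigma>
    using that sub by (auto simp: simplex_boundary_def full_simplex_def)
  have facet: "\<exists>v\<in>V - \<sigma>. V - {v} \<in> K" if \<sigma>: "\<sigma> \<in> K" for \<sigma>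
  proof -
    obtain \<tau> where \<tau>: "\<tau> \<in> K" "\<sigma> \<subseteq> \<tau>" "card \<tau> = d + 1"
      using pure \<sigma> unfolding pure_dim_def by blast
    have "card (V - \<tau>) = 1"
      using V \<tau> KV[OF \<tau>(1)] by (subst card_Diff_subset) (auto intro: finite_subset)
    then obtain v where v: "V - \<tau> = {v}" by (auto simp: card_1_singleton_iff)
    then have "V - {v} = \<tau>" using KV[OF \<tau>(1)] by blast
    then show ?thesis using v \<tau> by auto
  qed
  show "K = omitting V T"
  proof (intro set_eqI iffI)
    fix \<sigma> assume "\<sigma> \<in> K"
    then show "\<sigma> \<in> omitting V T"
      using facet[of \<sigma>] KV[of \<sigma>] by (auto simp: omitting_def T_def)
  next
    fix \<sigma> assume "\<sigma> \<in> omitting V T"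
    then obtain v where "\<sigma> \<subseteq> V - {v}" "V - {v} \<in> K" by (auto simp: omitting_def T_def)
    then show "\<sigma> \<in> K" using K unfolding simplicial_complex_def by blast
  qed
  obtain \<sigma> where "\<sigma> \<in> K" using pure by (auto simp: pure_dim_def)
  then show "T \<noteq> {}" using facet[of \<sigma>] by (auto simp: T_def)
qed

lemma simplicial_complex_omitting: "finite V \<Longrightarrow> simplicial_complex (omitting V T)"
  by (auto simp: simplicial_complex_def omitting_def intro: finite_subset)

lemma pure_dim_omitting:
  assumes V: "finite V" "card V = d + 2" and T: "T \<subseteq> V" "T \<noteq> {}"
  shows "pure_dim d (omitting V T)"
  unfolding pure_dim_def
proof (intro conjI ballI)
  show "omitting V T \<noteq> {}" using T by (auto simp: omitting_def)
next
  fix \<sigma> assume "\<sigma> \<in> omitting V T"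
  then obtain t where t: "t \<in> T" "\<sigma> \<subseteq> V - {t}" by (auto simp: omitting_def)
  have c: "card (V - {t}) = d + 1" using t T V by (auto simp: card_Diff_singleton)
  show "card \<sigma> \<le> d + 1" using card_mono[OF _ t(2)] V c by auto
  show "\<exists>\<tau>\<in>omitting V T. \<sigma> \<subseteq> \<tau> \<and> card \<tau> = d + 1"
    using t c by (intro bexI[of _ "V - {t}"]) (auto simp: omitting_def)
qed

section \<open>The realization is a ball\<close>

lemma compact_fun_box:
  fixes C :: "'a \<Rightarrow> 'b::topological_space set"
  assumes "\<And>v. compact (C v)"
  shows "compact {x. \<forall>v. x v \<in> C v}"
proof -
  have "compactin (product_topology (\<lambda>v. euclidean) UNIV) (PiE UNIV C)"
    using assms by (subst compactin_PiE) auto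
  then show ?thesis by (simp add: euclidean_product_topology PiE_UNIV_domain Pi_def)
qed

lemma continuous_on_coordinate: "continuous_on S (\<lambda>x. x v :: 'b::topological_space)"
  by (rule continuous_on_subset[OF continuous_on_product_coordinates]) simp

lemma continuous_on_Min_coordinates:
  assumes "finite B" "B \<noteq> {}"
  shows "continuous_on S (\<lambda>x::'v \<Rightarrow> real. Min (x ` B))"
  using assms
proof (induction rule: finite_ne_induct)
  case (insert b B)
  have "continuous_on S (\<lambda>x::'v \<Rightarrow> real. min (x b) (Min (x ` B)))"
    by (intro continuous_on_min continuous_on_coordinate insert.IH)
  then show ?case using insert by simp
qed (simp add: continuous_on_coordinate)

text \<open>Serves the radial rescaling at the apex of the cone. Where \<open>r\<close> vanishes,
  the quotient \<open>a / r\<close> stays bounded by 1 nearby while \<open>g\<close> tends to 0; the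
  limit agrees with the value 0 of a division by zero.\<close>

lemma continuous_on_divide_dominated:
  fixes a g r :: "'a::topological_space \<Rightarrow> real"
  assumes "continuous_on S a" "continuous_on S g" "continuous_on S r"
    and dom: "\<And>x. x \<in> S \<Longrightarrow> \<bar>a x\<bar> \<le> r x" and zero: "\<And>x. x \<in> S \<Longrightarrow> r x = 0 \<Longrightarrow> g x = 0"
  shows "continuous_on S (\<lambda>x. a x * g x / r x)"
  unfolding continuous_on_def
proof
  fix x assume x: "x \<in> S"
  note lim = assms(1-3)[unfolded continuous_on_def, rule_format, OF x]
  show "((\<lambda>x. a x * g x / r x) \<longlongrightarrow> a x * g x / r x) (at x within S)"
  proof (cases "r x = 0")
    case False
    then show ?thesis by (intro tendsto_intros lim)
  next
    case True
    have bound: "\<bar>a y * g y / r y\<bar> \<le> \<bar>g y\<bar>" if "y \<in> S" for y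
    proof -
      have "\<bar>a y\<bar> * \<bar>g y\<bar> \<le> \<bar>r y\<bar> * \<bar>g y\<bar>" using dom[OF that] by (intro mult_right_mono) auto
      then show ?thesis by (cases "r y = 0") (auto simp: abs_mult divide_simps mult.commute)
    qed
    have "\<forall>\<^sub>F y in at x within S. norm (a y * g y / r y) \<le> \<bar>g y\<bar>"
      unfolding eventually_at_filter by (rule always_eventually) (use bound in simp)
    moreover have "((\<lambda>y. \<bar>g y\<bar>) \<longlongrightarrow> 0) (at x within S)"
      using tendsto_rabs[OF lim(2)] zero[OF x True] by simp
    ultimately have "((\<lambda>y. a y * g y / r y) \<longlongrightarrow> 0) (at x within S)"
      by (rule Lim_null_comparison)
    then show ?thesis using True by simp
  qed
qed

text \<open>A point with \<open>x t = 0\<close> for some \<open>t\<close> in \<open>T\<close> is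
  carried by the facet \<open>V - {t}\<close>; conversely, a carrier in the complex misses some
  \<open>t\<close> in \<open>T\<close>.\<close>

lemma realization_omitting:
  assumes V: "finite V" and T: "T \<subseteq> V" "T \<noteq> {}"
  shows "realization (omitting V T) = top_of_set
    {x. (\<forall>v. 0 \<le> x v) \<and> (\<forall>v. v \<notin> V \<longrightarrow> x v = 0) \<and> sum x V = 1 \<and> (\<exists>t\<in>T. x t = 0)}"
proof -
  have "(\<exists>\<sigma>\<in>omitting V T. (\<forall>v. 0 \<le> x v) \<and> (\<forall>v. v \<notin> \<sigma> \<longrightarrow> x v = 0) \<and> sum x \<sigma> = 1) \<longleftrightarrow>
    (\<forall>v. 0 \<le> x v) \<and> (\<forall>v. v \<notin> V \<longrightarrow> x v = 0) \<and> sum x V = 1 \<and> (\<exists>t\<in>T. x t = 0)" (is "?L \<longleftrightarrow> ?R")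
    for x :: "'a \<Rightarrow> real"
  proof
    assume ?L
    then obtain \<sigma> where \<sigma>: "\<sigma> \<subseteq> V" "\<not> T \<subseteq> \<sigma>" "\<forall>v. 0 \<le> x v" "\<forall>v. v \<notin> \<sigma> \<longrightarrow> x v = 0" "sum x \<sigma> = 1"
      by (auto simp: omitting_def)
    have "sum x V = sum x \<sigma>" using \<sigma> V by (intro sum.mono_neutral_right) auto
    then show ?R using \<sigma> by auto
  next
    assume ?R
    then obtain t where t: "t \<in> T" "x t = 0" by blast
    have "sum x (V - {t}) = sum x V" using t T V by (simp add: sum_diff1)
    then show ?L using \<open>?R\<close> t T by (intro bexI[of _ "V - {t}"]) (auto simp: omitting_def)
  qed
  then show ?thesis by (simp add: realization_def euclidean_product_topology)
qed

lemma closed_ball_top_of_set: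
  "closed_ball d = top_of_set {z. (\<forall>i\<ge>d. z i = 0) \<and> L2_set z {..<d} \<le> 1}"
proof -
  have "{z. \<forall>i\<ge>d. z i = 0} \<inter> {z. (\<Sum>i<d. (z i)\<^sup>2) \<le> 1} =
      {z::nat \<Rightarrow> real. (\<forall>i\<ge>d. z i = 0) \<and> L2_set z {..<d} \<le> 1}"
    by (auto simp: L2_set_def)
  then show ?thesis
    by (simp only: closed_ball_def Euclidean_space_def euclidean_product_topology subtopology_subtopology)
qed

text \<open>The point \<open>c\<close> is the barycentre of \<open>V - T\<close>. The gauge
  \<open>g x = 1 - card (V - T) * Min (x ` (V - T))\<close> is positively homogeneous in \<open>x - c\<close>, and the
  realization is the part with \<open>g x \<le> 1\<close> of a cone with apex \<open>c\<close>. The coordinates \<open>\<phi>\<close>, which are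
  linear in \<open>x - c\<close>, forget one vertex of \<open>V - T\<close>, and one of \<open>T\<close> after subtracting its coordinate
  from the others in \<open>T\<close>; they map the cone bijectively onto \<open>d\<close>-space. Rescaling \<open>\<phi> x\<close> radially
  to norm \<open>g x\<close> gives the homeomorphism.\<close>

lemma simplicial_ball_omitting:
  fixes V :: "'v set"
  assumes V: "finite V" "card V = d + 2" and T: "T \<subset> V" "T \<noteq> {}"
  shows "simplicial_ball d (omitting V T)"
proof -
  define B where "B = V - T"
  define m where "m = real (card B)"
  have fin: "finite B" "finite T" using V T by (auto simp: B_def intro: finite_subset)
  have B: "B \<noteq> {}" "B \<inter> T = {}" "V = B \<union> T" "\<And>t. t \<in> T \<Longrightarrow> t \<notin> B" using T by (auto simp: B_def)
  have m: "m > 0" using B fin by (auto simp: m_def card_gt_0_iff)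
  obtain b0 t0 where b0: "b0 \<in> B" and t0: "t0 \<in> T" using B T by blast
  define I where "I = V - {b0, t0}"
  have "card I = d" unfolding I_def using b0 t0 B V by (subst card_Diff_subset) (auto simp: card_insert_if)
  moreover have finI: "finite I" using V by (simp add: I_def)
  ultimately obtain h where h: "bij_betw h {..<d} I"
    by (metis atLeast0LessThan ex_bij_betw_nat_finite)
  have hI: "h i \<in> I" if "i < d" for i using h that by (auto simp: bij_betw_def)
  define S where "S = {x::'v \<Rightarrow> real. (\<forall>v. 0 \<le> x v) \<and> (\<forall>v. v \<notin> V \<longrightarrow> x v = 0) \<and> sum x V = 1 \<and> (\<exists>t\<in>T. x t = 0)}"
  define Z where "Z = {z::nat \<Rightarrow> real. (\<forall>i\<ge>d. z i = 0) \<and> L2_set z {..<d} \<le> 1}"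
  define g where "g x = 1 - m * Min (x ` B)" for x :: "'v \<Rightarrow> real"
  define c where "c v = (if v \<in> B then 1 / m else 0)" for v
  define \<phi> where "\<phi> x i = (if i < d then if h i \<in> B then x (h i) - 1 / m else x (h i) - x t0 else 0)"
    for x :: "'v \<Rightarrow> real" and i
  define r where "r x = L2_set (\<phi> x) {..<d}" for x
  \<comment> \<open>At the apex, where \<open>r c = 0\<close>, division by zero sends
    \<open>c\<close> to the centre of the ball.\<close>
  define F where "F x i = \<phi> x i * g x / r x" for x i
  have SD: "0 \<le> x v" "v \<notin> V \<Longrightarrow> x v = 0" "sum x B + sum x T = 1" "\<exists>t\<in>T. x t = 0" if "x \<in> S" for x v
    using that B fin unfolding S_def by (auto simp: sum.union_disjoint)
  have Min_le: "Min (x ` B) \<le> x b" if "b \<in> B" for x :: "'v \<Rightarrow> real" and b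
    using that fin by auto
  have Min_ex: "\<exists>b\<in>B. Min (x ` B) = x b" for x :: "'v \<Rightarrow> real"
  proof -
    have "Min (x ` B) \<in> x ` B" using fin B by (intro Min_in) auto
    then show ?thesis by blast
  qed
  have g_ge: "1 - g x \<le> m * x b" if "b \<in> B" for x b
    using Min_le[OF that, of x] m unfolding g_def by simp
  have g1: "g x \<le> 1" if "x \<in> S" for x
    using Min_ex[of x] SD(1)[OF that] m by (auto simp: g_def)
  have sumB: "1 - g x \<le> sum x B" for x
  proof -
    have "(\<Sum>b\<in>B. Min (x ` B)) \<le> sum x B" by (intro sum_mono Min_le)
    then show ?thesis by (simp add: g_def m_def)
  qed
  have g0: "g x \<ge> 0" if "x \<in> S" for x
    using sumB[of x] SD(3)[OF that] sum_nonneg[of T x] SD(1)[OF that] by simp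
  \<comment> \<open>Proportional \<open>\<phi>\<close>-values force proportional displacement from
    \<open>c\<close>. Both points have a vanishing \<open>T\<close>-coordinate; evaluating at the
    zero of \<open>x\<close> and at the zero of \<open>y\<close> pins down the coordinate at
    \<open>t0\<close>. The total sum 1 then pins down the one at \<open>b0\<close>.\<close>
  have cone_eqI: "x v = c v + l * (y v - c v)"
    if xy: "x \<in> S" "y \<in> S" and "l > 0" and eq: "\<And>i. i < d \<Longrightarrow> \<phi> x i = l * \<phi> y i" for x y l v
  proof -
    have eI: "if v \<in> B then x v - 1 / m = l * (y v - 1 / m) else x v - x t0 = l * (y v - y t0)" if vI: "v \<in> I" for v
    proof -
      obtain i where "i < d" "v = h i" using bij_betw_imp_surj_on[OF h] vI by (metis imageE lessThan_iff)
      then show ?thesis using eq[of i] by (auto simp: \<phi>_def split: if_splits)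
    qed
    have eT: "x t - x t0 = l * (y t - y t0)" if "t \<in> T" for t
      using eI[of t] that B b0 by (cases "t = t0") (auto simp: I_def)
    have "x t0 = l * y t0"
    proof (rule antisym)
      obtain t where "t \<in> T" "x t = 0" using SD(4) xy by blast
      then have "x t0 = l * y t0 - l * y t" using eT[of t] by (simp add: algebra_simps)
      then show "x t0 \<le> l * y t0" using SD(1)[OF xy(2), of t] \<open>l > 0\<close> by simp
      obtain t where "t \<in> T" "y t = 0" using SD(4) xy by blast
      then show "l * y t0 \<le> x t0" using eT[of t] SD(1)[OF xy(1), of t] by simp
    qed
    then have eT: "x t = l * y t" if "t \<in> T" for t using eT[OF that] by (simp add: algebra_simps)
    have eB': "x b - 1 / m = l * (y b - 1 / m)" if "b \<in> B - {b0}" for b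
      using eI[of b] that B t0 by (auto simp: I_def)
    have "sum x T = l * sum y T" using eT by (simp add: sum_distrib_left)
    moreover have "(\<Sum>b\<in>B-{b0}. x b - 1 / m) = l * (\<Sum>b\<in>B-{b0}. y b - 1 / m)"
      using eB' by (simp add: sum_distrib_left)
    moreover have "(\<Sum>b\<in>B. x b - 1 / m) = - sum x T" if "x \<in> S" for x
      using SD(3)[OF that] m by (simp add: sum_subtractf m_def)
    then have "(\<Sum>b\<in>B-{b0}. x b - 1 / m) = - sum x T - (x b0 - 1 / m)" if "x \<in> S" for x
      using that fin b0 by (simp add: sum_diff1)
    ultimately have "x b0 - 1 / m = l * (y b0 - 1 / m)" using xy by (simp add: algebra_simps)
    then have "x b - 1 / m = l * (y b - 1 / m)" if "b \<in> B" for b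
      using that eB' by (cases "b = b0") auto
    then show ?thesis using eT[of v] SD(2)[OF xy(1), of v] SD(2)[OF xy(2), of v] B
      by (cases "v \<in> B"; cases "v \<in> T") (auto simp: c_def algebra_simps)
  qed
  have cS: "c \<in> S"
  proof -
    have "sum c V = sum c B" using B V by (intro sum.mono_neutral_right) (auto simp: c_def)
    also have "\<dots> = 1" using m by (simp add: c_def m_def)
    finally show ?thesis using B t0 m by (auto simp: S_def c_def intro!: bexI[of _ t0])
  qed
  have \<phi>c: "\<phi> c i = 0" for i using hI[of i] b0 t0 B by (auto simp: \<phi>_def c_def I_def)
  have gc: "g c = 0"
  proof -
    have "c ` B = {1 / m}" using b0 by (auto simp: c_def)
    then show ?thesis using m by (simp add: g_def)
  qed
  have r_nonneg: "r x \<ge> 0" for x by (simp add: r_def L2_set_nonneg)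
  have r0: "x = c" if "x \<in> S" "r x = 0" for x
  proof -
    have "\<phi> x i = 0" if "i < d" for i using \<open>r x = 0\<close> that by (auto simp: r_def L2_set_eq_0_iff)
    then show ?thesis using cone_eqI[OF \<open>x \<in> S\<close> cS, of 1] \<phi>c by auto
  qed
  \<comment> \<open>If \<open>g x = 0\<close>, all coordinates in \<open>B\<close> are at least
    \<open>1 / m\<close>, while their sum is at most 1. So they all equal \<open>1 / m\<close> and
    nothing is left for \<open>T\<close>.\<close>
  have gz: "x = c" if "x \<in> S" "g x = 0" for x
  proof -
    have "sum x T = 0" using sumB[of x] SD[OF that(1)] that(2) sum_nonneg[of T x] by auto
    then have xT: "x t = 0" if "t \<in> T" for t
      using that SD(1)[OF \<open>x \<in> S\<close>] fin by (simp add: sum_nonneg_eq_0_iff)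
    have ge: "0 \<le> x b - 1 / m" if "b \<in> B" for b using g_ge[OF that, of x] \<open>g x = 0\<close> m by (simp add: field_simps)
    have "(\<Sum>b\<in>B. x b - 1 / m) = 0"
      using SD(3)[OF that(1)] \<open>sum x T = 0\<close> m by (simp add: sum_subtractf m_def)
    then have "x b - 1 / m = 0" if "b \<in> B" for b
      using that ge fin by (simp add: sum_nonneg_eq_0_iff)
    then show ?thesis using xT SD(2)[OF \<open>x \<in> S\<close>] B by (auto simp: c_def fun_eq_iff)
  qed
  have LF: "L2_set (F x) {..<d} = g x" if "x \<in> S" for x
  proof (cases "r x = 0")
    case True
    then have "x = c" using r0 that by simp
    then show ?thesis using gc by (simp add: F_def L2_set_def)
  next
    case False
    have "L2_set (F x) {..<d} = L2_set (\<lambda>i. (g x / r x) * \<phi> x i) {..<d}"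
      by (intro L2_set_cong) (simp_all add: F_def)
    also have "\<dots> = (g x / r x) * r x"
      unfolding r_def[of x, symmetric] using g0[OF that] r_nonneg[of x]
      by (subst L2_set_right_distrib[symmetric]) (auto simp: r_def)
    finally show ?thesis using False by simp
  qed

  have contF: "continuous_on S F"
  proof (rule continuous_on_coordinatewise_then_product)
    have c\<phi>: "continuous_on S (\<lambda>x. \<phi> x i)" for i
      unfolding \<phi>_def by (cases "i < d"; cases "h i \<in> B") (auto intro!: continuous_intros continuous_on_coordinate)
    fix i show "continuous_on S (\<lambda>x. F x i)"
      unfolding F_def
    proof (rule continuous_on_divide_dominated[OF c\<phi>])
      show "continuous_on S g" unfolding g_def
        using fin B by (intro continuous_intros continuous_on_Min_coordinates)
      show "continuous_on S r" unfolding r_def L2_set_def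
        by (intro continuous_intros c\<phi>)
      show "\<bar>\<phi> x i\<bar> \<le> r x" for x
      proof (cases "i < d")
        case True
        then show ?thesis unfolding r_def
          using member_le_L2_set[of "{..<d}" i "\<lambda>i. \<bar>\<phi> x i\<bar>"] by (simp add: L2_set_def)
      qed (auto simp: \<phi>_def r_nonneg)
      show "g x = 0" if "x \<in> S" "r x = 0" for x using r0[OF that] gc by simp
    qed
  qed
  have compS: "compact S"
  proof -
    have "compact {x::'v \<Rightarrow> real. \<forall>v. x v \<in> {0..1}}" by (rule compact_fun_box) simp
    moreover have "closed S"
    proof -
      have "S = {x. \<forall>v. 0 \<le> x v} \<inter> {x. \<forall>v. v \<notin> V \<longrightarrow> x v = 0} \<inter> {x. sum x V = 1} \<inter> (\<Union>t\<in>T. {x. x t = 0})"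
        by (auto simp: S_def)
      also have "closed \<dots>"
        by (intro closed_Int closed_UN ballI closed_Collect_all closed_Collect_imp closed_Collect_eq
            closed_Collect_le continuous_on_sum continuous_on_coordinate continuous_on_const fin open_Collect_const)
      finally show ?thesis .
    qed
    moreover have "S \<subseteq> {x. \<forall>v. x v \<in> {0..1}}"
    proof clarsimp
      fix x v assume x: "x \<in> S"
      have "x v \<le> sum x V" if "v \<in> V" using that V SD(1)[OF x] by (intro member_le_sum) auto
      then show "0 \<le> x v \<and> x v \<le> 1" using SD(1,2)[OF x, of v] x by (cases "v \<in> V") (auto simp: S_def)
    qed
    ultimately show ?thesis by (metis compact_Int_closed inf.absorb_iff2)
  qed
  have injF: "inj_on F S"
  proof (rule inj_onI)
    fix x y assume xy: "x \<in> S" "y \<in> S" and eq: "F x = F y"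
    have gg: "g x = g y" using LF xy eq by metis
    show "x = y"
    proof (cases "g x = 0")
      case True
      then show ?thesis using gz xy gg by metis
    next
      case False
      then have pos: "r x > 0" "r y > 0" using r0 xy gc gg r_nonneg by (metis less_eq_real_def)+
      \<comment> \<open>Equal images have equal norm \<open>g\<close>, so \<open>\<phi> x\<close>
        and \<open>\<phi> y\<close> are parallel with ratio \<open>l\<close>, and \<open>x\<close>,
        \<open>y\<close> lie on one ray from \<open>c\<close>.\<close>
      define l where "l = r x / r y"
      have "\<phi> x i = l * \<phi> y i" for i
        using fun_cong[OF eq, of i] False pos gg by (simp add: F_def l_def field_simps)
      then have lin: "x v = c v + l * (y v - c v)" for v
        using pos by (intro cone_eqI[OF xy]) (auto simp: l_def)
      \<comment> \<open>Evaluating at the minimal coordinate of \<open>x\<close> bounds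
        \<open>g x\<close> from above. The same bound with the roles exchanged and factor
        \<open>1 / l\<close> then forces \<open>l = 1\<close>.\<close>
      have gl: "g x \<le> l * g y" if "l > 0" and lin: "\<And>v. x v = c v + l * (y v - c v)" for x y l
      proof -
        obtain b where b: "b \<in> B" "Min (x ` B) = x b" using Min_ex by blast
        have "x b = 1 / m + l * (y b - 1 / m)" using b(1) lin[of b] by (simp add: c_def)
        then have "m * x b = m * (1 / m) + l * (m * y b - m * (1 / m))"
          by (simp only: distrib_left right_diff_distrib mult.left_commute)
        then have "g x = l * (1 - m * y b)" using m b(2) by (simp add: g_def algebra_simps)
        also have "\<dots> \<le> l * g y" using g_ge[OF b(1), of y] that(1) by (intro mult_left_mono) auto
        finally show ?thesis .
      qed
      have "l > 0" using pos by (simp add: l_def)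
      have "g x \<le> l * g y" by (rule gl) (use lin \<open>l > 0\<close> in auto)
      moreover have "g y \<le> (1 / l) * g x" by (rule gl) (use lin \<open>l > 0\<close> in auto)
      moreover have "g y > 0" using False gg g0[OF xy(1)] by simp
      ultimately have "l = 1" using gg \<open>l > 0\<close> by (simp add: field_simps)
      then show ?thesis using lin by auto
    qed
  qed
  have FZ: "F x \<in> Z" if "x \<in> S" for x
    using LF[OF that] g1[OF that] by (auto simp: Z_def F_def \<phi>_def)
  have surj: "z \<in> F ` S" if z: "z \<in> Z" for z
  proof (cases "L2_set z {..<d} = 0")
    case True
    then have "z i = 0" for i using z by (cases "i < d") (auto simp: L2_set_eq_0_iff Z_def)
    moreover have "F c i = 0" for i using gc by (simp add: F_def)
    ultimately have "z = F c" by auto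
    then show ?thesis using cS by blast
  next
    case False
    define n where "n = L2_set z {..<d}"
    have n: "0 < n" "n \<le> 1" using False z by (auto simp: n_def Z_def order_less_le)
    \<comment> \<open>Transports \<open>z\<close> back to the vertices. The two vertices forgotten
      by \<open>\<phi>\<close> get the value 0.\<close>
    define w where "w v = (if v \<in> I then z (inv_into {..<d} h v) else 0)" for v
    have wh: "w (h i) = z i" if "i < d" for i
      using that hI h by (auto simp: w_def bij_betw_def inv_into_f_f)
    define a where "a = Min (w ` T)"
    have a: "a \<le> w t" if "t \<in> T" for t using that fin by (auto simp: a_def)
    have "a \<in> w ` T" unfolding a_def using fin T by (intro Min_in) auto
    then obtain ta where ta: "ta \<in> T" "w ta = a" by blast
    \<comment> \<open>A direction of the cone at \<open>c\<close>: subtracting the minimum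
      \<open>a\<close> makes the \<open>T\<close>-part nonnegative with a zero at \<open>ta\<close>,
      and the entry at \<open>b0\<close> makes the total sum 0.\<close>
    define y where "y v = (if v \<in> T then w v - a else if v = b0 then
        - (\<Sum>t\<in>T. w t - a) - sum w (B - {b0}) else if v \<in> B then w v else 0)" for v
    have yT: "y t = w t - a" if "t \<in> T" for t using that by (simp add: y_def)
    have yB: "y b = w b" if "b \<in> B - {b0}" for b using that B by (auto simp: y_def)
    have y0: "y v = 0" if "v \<notin> V" for v using that B b0 by (auto simp: y_def)
    have "sum y B = y b0 + sum y (B - {b0})" using fin b0 by (simp add: sum.remove)
    also have "sum y (B - {b0}) = sum w (B - {b0})" using yB by (intro sum.cong) auto
    also have "y b0 = - (\<Sum>t\<in>T. w t - a) - sum w (B - {b0})" using b0 B by (auto simp: y_def)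
    also have "(\<Sum>t\<in>T. w t - a) = sum y T" using yT by (intro sum.cong) auto
    finally have ysum: "sum y B + sum y T = 0" by simp
    define q where "q = Min (y ` B)"
    have q: "q \<le> y b" if "b \<in> B" for b using that Min_le by (simp add: q_def)
    \<comment> \<open>Otherwise all entries of \<open>y\<close> would be nonnegative with sum 0,
      hence zero. Then \<open>w\<close> would be constant on \<open>T\<close> with value
      \<open>w t0 = 0\<close>, and \<open>z\<close> would vanish.\<close>
    have "q < 0"
    proof (rule ccontr)
      assume "\<not> q < 0"
      then have pB: "0 \<le> y b" if "b \<in> B" for b using q[OF that] by simp
      have pT: "0 \<le> y t" if "t \<in> T" for t using yT a that by simp
      have "sum y B = 0" "sum y T = 0" using ysum sum_nonneg[of B y] sum_nonneg[of T y] pB pT by auto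
      then have zero: "y v = 0" if "v \<in> V" for v
        using that B fin pB pT by (auto simp: sum_nonneg_eq_0_iff)
      have "w t0 = 0" by (simp add: w_def I_def)
      then have "a = 0" using yT[OF t0] zero[of t0] t0 B by auto
      then have "w v = 0" if "v \<in> I" for v
        using that zero[of v] yT[of v] yB[of v] B by (auto simp: I_def)
      then have "z i = 0" if "i < d" for i using wh[OF that] hI[OF that] by simp
      then show False using False by (simp add: L2_set_def)
    qed
    \<comment> \<open>Solves \<open>g (c + s y) = n\<close>: by \<open>m * (1 / m) = 1\<close>, the
      gauge along this ray is \<open>- m * s * q\<close>.\<close>
    define s where "s = n / (m * - q)"
    have s: "s > 0" using n m \<open>q < 0\<close> by (simp add: s_def divide_pos_neg mult_pos_neg)
    have sq: "m * (s * q) = - n" using m \<open>q < 0\<close> by (simp add: s_def)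
    define x where "x v = c v + s * y v" for v
    have xB: "x b = 1 / m + s * y b" if "b \<in> B" for b using that by (simp add: x_def c_def)
    have xT: "x t = s * y t" if "t \<in> T" for t using that B by (auto simp: x_def c_def)
    have gx: "g x = n"
    proof -
      have "x ` B = (\<lambda>u. 1 / m + s * u) ` (y ` B)" using xB by (auto simp: image_image)
      moreover have "Min ((\<lambda>u. 1 / m + s * u) ` (y ` B)) = 1 / m + s * q"
        unfolding q_def using s fin B by (subst mono_Min_commute[symmetric]) (auto simp: mono_def)
      ultimately show ?thesis using sq m by (simp add: g_def distrib_left)
    qed
    have xS: "x \<in> S" unfolding S_def
    proof (intro CollectI conjI allI impI)
      have xV: "x v = 0" if "v \<notin> V" for v using that y0 B by (auto simp: x_def c_def)
      show "0 \<le> x v" for v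
      proof -
        have "0 \<le> x v" if "v \<in> B"
        proof -
          have "0 \<le> m * x v" using g_ge[OF that, of x] gx n by simp
          then show ?thesis using m by (simp add: zero_le_mult_iff)
        qed
        moreover have "0 \<le> x v" if "v \<in> T" using xT[OF that] yT[OF that] a[OF that] s by simp
        moreover have "0 \<le> x v" if "v \<notin> V" using that xV by simp
        ultimately show ?thesis using B(3) by blast
      qed
      show "x v = 0" if "v \<notin> V" for v using that by (rule xV)
      have "sum x V = sum c V + s * sum y V" by (simp add: x_def sum.distrib sum_distrib_left)
      also have "sum y V = 0" using ysum B fin by (simp add: sum.union_disjoint)
      also have "sum c V = 1" using cS by (simp add: S_def)
      finally show "sum x V = 1" by simp
      show "\<exists>t\<in>T. x t = 0" using ta xT[OF ta(1)] yT[OF ta(1)] by auto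
    qed
    have \<phi>x: "\<phi> x i = s * z i" if "i < d" for i
    proof -
      have hi: "h i \<in> I" "w (h i) = z i" using hI wh that by auto
      have "w t0 = 0" by (simp add: w_def I_def)
      then show ?thesis
        using that hi xB[of "h i"] yB[of "h i"] xT[of "h i"] yT[of "h i"] xT[OF t0] yT[OF t0] B
        by (auto simp: \<phi>_def I_def algebra_simps)
    qed
    have "r x = L2_set (\<lambda>i. s * z i) {..<d}" unfolding r_def using \<phi>x by (intro L2_set_cong) auto
    then have rx: "r x = s * n" using s by (simp add: L2_set_right_distrib n_def)
    have "F x i = z i" for i
    proof (cases "i < d")
      case True
      then show ?thesis using \<phi>x[OF True] rx gx s n by (simp add: F_def)
    next
      case False
      then show ?thesis using z by (simp add: F_def \<phi>_def Z_def)
    qed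
    then have "z = F x" by auto
    then show ?thesis using xS by blast
  qed
  \<comment> \<open>A continuous bijection from a compact space to a Hausdorff space is a
    homeomorphism, so the inverse needs no separate treatment.\<close>
  have "homeomorphic_map (top_of_set S) (top_of_set Z) F"
  proof (rule continuous_imp_homeomorphic_map)
    show "continuous_map (top_of_set S) (top_of_set Z) F"
      using contF FZ by (auto simp: continuous_map_subtopology_eu)
    show "compact_space (top_of_set S)" using compS by (simp add: compact_space_subtopology)
    show "Hausdorff_space (top_of_set Z)" by (simp add: Hausdorff_space_subtopology)
    show "F ` topspace (top_of_set S) = topspace (top_of_set Z)" using FZ surj by auto
    show "inj_on F (topspace (top_of_set S))" using injF by simp
  qed
  then have "realization (omitting V T) homeomorphic_space closed_ball d"
    unfolding realization_omitting[OF V(1) psubset_imp_subset[OF T(1)] T(2)] closed_ball_top_of_set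
      S_def[symmetric] Z_def[symmetric]
    by (rule homeomorphic_map_imp_homeomorphic_space)
  moreover have "finite (omitting V T)"
    by (rule finite_subset[of _ "Pow V"]) (use V in \<open>auto simp: omitting_def\<close>)
  ultimately show ?thesis
    using simplicial_complex_omitting[OF V(1)] by (simp add: simplicial_ball_def)
qed

section \<open>Stages of the subdivision\<close>

text \<open>The complex obtained from \<open>omitting (Old ` {..d+1}) (Old ` T)\<close> by the first \<open>i\<close> subdivision
  steps. The last condition says that the face lies in the subdivision of the facet opposite to
  \<open>Old t\<close>: this facet contains \<open>diamond_face d n\<close> iff \<open>t \<le> n\<close>.\<close>

definition diamond_stage :: "nat \<Rightarrow> nat set \<Rightarrow> nat \<Rightarrow> vertex complex" where
  "diamond_stage d T i = {\<sigma>. \<sigma> \<subseteq> Old ` {..d+1} \<union> New ` {..<i} \<and> (\<forall>n. \<not> (Old n \<in> \<sigma> \<and> New n \<in> \<sigma>))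
     \<and> (\<exists>n\<in>{i..d+1}. Old n \<notin> \<sigma>) \<and> (\<exists>t\<in>T. Old t \<notin> \<sigma> \<and> (\<forall>n<t. New n \<notin> \<sigma>))}"

lemma diamond_stage_0:
  assumes "T \<subseteq> {..d+1}"
  shows "diamond_stage d T 0 = omitting (Old ` {..d+1}) (Old ` T)"
proof -
  have "\<exists>n\<in>{0..d+1}. Old n \<notin> \<sigma>" if "t \<in> T" "Old t \<notin> \<sigma>" for t \<sigma>
    using that assms by (intro bexI[of _ t]) auto
  then show ?thesis by (auto simp: diamond_stage_def omitting_def)
qed

lemma diamond_stage_subset_closed:
  "\<sigma> \<in> diamond_stage d T i \<Longrightarrow> \<tau> \<subseteq> \<sigma> \<Longrightarrow> \<tau> \<in> diamond_stage d T i"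
  unfolding diamond_stage_def by blast

text \<open>The face has no \<open>New\<close> vertices, and among the \<open>Old\<close> ones it
  misses just those with index at most \<open>i\<close>. So this decides whether step
  \<open>i\<close> subdivides.\<close>

lemma diamond_face_in_stage:
  assumes "T \<subseteq> {..d+1}" "i \<le> d"
  shows "diamond_face d i \<in> diamond_stage d T i \<longleftrightarrow> (\<exists>t\<in>T. t \<le> i)"
proof
  assume "diamond_face d i \<in> diamond_stage d T i"
  then obtain t where "t \<in> T" "Old t \<notin> diamond_face d i" unfolding diamond_stage_def by blast
  then show "\<exists>t\<in>T. t \<le> i" using assms by (auto simp: diamond_face_def image_iff intro!: bexI[of _ t])
next
  assume "\<exists>t\<in>T. t \<le> i"
  then obtain t where "t \<in> T" "t \<le> i" by blast
  then show "diamond_face d i \<in> diamond_stage d T i"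
    using assms unfolding diamond_stage_def
    by (intro CollectI conjI bexI[of _ t] bexI[of _ i]) (auto simp: diamond_face_def image_iff)
qed

text \<open>If all of \<open>T\<close> lies above \<open>i\<close>, the step is idle: the missing
  \<open>Old t\<close> has \<open>t > i\<close>, and \<open>New i\<close> is excluded by
  \<open>i < t\<close>. Otherwise the faces of the next stage without \<open>New i\<close> form the
  deletion, and those with \<open>New i\<close> split into \<open>New i\<close>, a proper part of
  \<open>F\<close> and a face of the link.\<close>

lemma diamond_step_stage:
  assumes T: "T \<subseteq> {..d+1}" and i: "i \<le> d"
  shows "diamond_step d i (diamond_stage d T i) = diamond_stage d T (Suc i)"
proof (cases "\<exists>t\<in>T. t \<le> i")
  case False
  then have "\<And>t. t \<in> T \<Longrightarrow> i < t" by (auto simp: not_le)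
  then have "diamond_stage d T i = diamond_stage d T (Suc i)"
  proof (intro set_eqI iffI)
    fix \<sigma> assume \<sigma>: "\<sigma> \<in> diamond_stage d T i"
    then obtain t where "t \<in> T" "Old t \<notin> \<sigma>" unfolding diamond_stage_def by blast
    with \<open>\<And>t. t \<in> T \<Longrightarrow> i < t\<close> T have "\<exists>n\<in>{Suc i..d+1}. Old n \<notin> \<sigma>"
      by (intro bexI[of _ t]) (auto simp: Suc_le_eq)
    with \<sigma> show "\<sigma> \<in> diamond_stage d T (Suc i)"
      unfolding diamond_stage_def lessThan_Suc by blast
  next
    fix \<sigma> assume \<sigma>: "\<sigma> \<in> diamond_stage d T (Suc i)"
    then have "New i \<notin> \<sigma>" using \<open>\<And>t. t \<in> T \<Longrightarrow> i < t\<close> unfolding diamond_stage_def by blast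
    moreover have "{Suc i..d+1} \<subseteq> {i..d+1}" by auto
    ultimately show "\<sigma> \<in> diamond_stage d T i"
      using \<sigma> unfolding diamond_stage_def lessThan_Suc by blast
  qed
  then show ?thesis using False diamond_face_in_stage[OF T i] unfolding diamond_step_def by auto
next
  case True
  define F where "F = diamond_face d i"
  define K where "K = diamond_stage d T i"
  have step: "diamond_step d i K = stellar_subdivision K F (New i)"
    using True by (simp add: diamond_step_def diamond_face_in_stage[OF T i] K_def F_def)
  have old: "\<sigma> \<in> deletion K F \<longleftrightarrow> \<sigma> \<in> diamond_stage d T (Suc i) \<and> New i \<notin> \<sigma>" for \<sigma>
  proof -
    \<comment> \<open>Avoiding \<open>F\<close> is exactly the missing-vertex condition of the next
      stage.\<close>
    have "\<not> F \<subseteq> \<sigma> \<longleftrightarrow> (\<exists>n\<in>{Suc i..d+1}. Old n \<notin> \<sigma>)"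
      by (auto simp: F_def diamond_face_def)
    moreover have "\<sigma> \<subseteq> Old ` {..d+1} \<union> New ` {..<i} \<longleftrightarrow>
        \<sigma> \<subseteq> Old ` {..d+1} \<union> New ` {..<Suc i} \<and> New i \<notin> \<sigma>"
      by (auto simp: lessThan_Suc)
    moreover have "\<exists>n\<in>{i..d+1}. Old n \<notin> \<sigma>" if "\<exists>n\<in>{Suc i..d+1}. Old n \<notin> \<sigma>"
      using that by (meson Suc_leD atLeastAtMost_iff)
    ultimately show ?thesis
      unfolding deletion_def K_def diamond_stage_def mem_Collect_eq by satx
  qed
  have new: "insert (New i) (\<alpha> \<union> \<beta>) \<in> diamond_stage d T (Suc i)"
    if \<alpha>: "\<alpha> \<subset> F" and \<beta>: "\<beta> \<in> link K F" for \<alpha> \<beta>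
  proof -
    have "F \<union> \<beta> \<in> K" using \<beta> by (auto simp: link_def)
    then obtain t where t: "t \<in> T" "Old t \<notin> F \<union> \<beta>" "\<forall>n<t. New n \<notin> \<beta>"
      and anti: "\<forall>n. \<not> (Old n \<in> \<beta> \<and> New n \<in> \<beta>)" and sub: "\<beta> \<subseteq> Old ` {..d+1} \<union> New ` {..<i}"
      and n: "\<exists>n\<in>{i..d+1}. Old n \<notin> F \<union> \<beta>"
      unfolding K_def diamond_stage_def by blast
    have ti: "t \<le> i" using t T by (auto simp: F_def diamond_face_def image_iff)
    obtain n where "n \<in> {i..d+1}" "Old n \<notin> F \<union> \<beta>" using n by blast
    \<comment> \<open>\<open>F\<close> covers all indices from \<open>i + 1\<close> on, so the
      vertex missing from \<open>F \<union> \<beta>\<close> is \<open>Old i\<close>. Hence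
      \<open>New i\<close> can be added without creating an antipodal pair.\<close>
    then have "n = i" by (auto simp: F_def diamond_face_def image_iff)
    then have iF: "Old i \<notin> F \<union> \<beta>" using \<open>Old n \<notin> _\<close> by simp
    have FO: "\<alpha> \<subseteq> Old ` {Suc i..d+1}" using \<alpha> by (auto simp: F_def diamond_face_def)
    obtain m where m: "m \<in> {Suc i..d+1}" "Old m \<notin> \<alpha>"
      using psubset_imp_ex_mem[OF \<alpha>] by (auto simp: F_def diamond_face_def)
    have "Old m \<in> F" using m by (auto simp: F_def diamond_face_def)
    then have "Old m \<notin> \<beta>" using \<beta> by (auto simp: link_def)
    have "\<not> (Old n \<in> insert (New i) (\<alpha> \<union> \<beta>) \<and> New n \<in> insert (New i) (\<alpha> \<union> \<beta>))" for n
      using anti FO sub iF \<alpha> by fastforce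
    moreover have "\<exists>n\<in>{Suc i..d+1}. Old n \<notin> insert (New i) (\<alpha> \<union> \<beta>)"
      using m \<open>Old m \<notin> \<beta>\<close> by (intro bexI[of _ m]) auto
    moreover have "Old t \<notin> insert (New i) (\<alpha> \<union> \<beta>)" "\<forall>n<t. New n \<notin> insert (New i) (\<alpha> \<union> \<beta>)"
      using t ti FO \<alpha> by auto
    moreover have "insert (New i) (\<alpha> \<union> \<beta>) \<subseteq> Old ` {..d+1} \<union> New ` {..<Suc i}"
      using FO sub by (auto simp: lessThan_Suc)
    ultimately show ?thesis using t(1) unfolding diamond_stage_def mem_Collect_eq by blast
  qed
  have star: "\<exists>\<alpha> \<beta>. \<alpha> \<subset> F \<and> \<beta> \<in> link K F \<and> \<sigma> = insert (New i) (\<alpha> \<union> \<beta>)"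
    if \<sigma>: "\<sigma> \<in> diamond_stage d T (Suc i)" "New i \<in> \<sigma>" for \<sigma>
  proof (intro exI conjI)
    define \<beta> where "\<beta> = \<sigma> - {New i} - F"
    show "\<sigma> = insert (New i) (\<sigma> \<inter> F \<union> (\<sigma> - {New i} - F))" using \<sigma>
      by (auto simp: F_def diamond_face_def)
    show "\<sigma> \<inter> F \<subset> F" using \<sigma> by (auto simp: F_def diamond_face_def diamond_stage_def)
    obtain t where t: "t \<in> T" "Old t \<notin> \<sigma>" "\<forall>n<t. New n \<notin> \<sigma>"
      using \<sigma> unfolding diamond_stage_def by blast
    have ti: "t \<le> i" using t \<sigma> by (meson not_le)
    have Fi: "Old n \<in> F \<longleftrightarrow> i < n \<and> n \<le> d+1" "New n \<notin> F" for n
      by (auto simp: F_def diamond_face_def)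
    have sub: "\<sigma> \<subseteq> Old ` {..d+1} \<union> New ` {..<Suc i}" and
      anti: "\<not> (Old n \<in> \<sigma> \<and> New n \<in> \<sigma>)" for n
      using \<sigma> unfolding diamond_stage_def by blast+
    have "F \<union> \<beta> \<in> K" unfolding K_def diamond_stage_def
    proof (intro CollectI conjI)
      show "F \<union> \<beta> \<subseteq> Old ` {..d+1} \<union> New ` {..<i}"
        using sub by (auto simp: \<beta>_def F_def diamond_face_def lessThan_Suc)
      show "\<forall>n. \<not> (Old n \<in> F \<union> \<beta> \<and> New n \<in> F \<union> \<beta>)"
        using anti sub by (fastforce simp: \<beta>_def Fi)
      \<comment> \<open>\<open>New i\<close> in \<open>\<sigma>\<close> excludes its antipode
        \<open>Old i\<close>, and \<open>F\<close> begins only at \<open>i + 1\<close>.\<close>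
      show "\<exists>n\<in>{i..d+1}. Old n \<notin> F \<union> \<beta>"
        using anti[of i] \<sigma> i by (intro bexI[of _ i]) (auto simp: Fi \<beta>_def)
      show "\<exists>t\<in>T. Old t \<notin> F \<union> \<beta> \<and> (\<forall>n<t. New n \<notin> F \<union> \<beta>)"
        using t ti by (intro bexI[of _ t]) (auto simp: Fi \<beta>_def)
    qed
    moreover from this have "\<beta> \<in> K"
      unfolding K_def by (rule diamond_stage_subset_closed) auto
    ultimately show "\<sigma> - {New i} - F \<in> link K F" by (auto simp: link_def \<beta>_def)
  qed
  \<comment> \<open>The join also contains faces without \<open>New i\<close>; these already lie in
    the deletion.\<close>
  have low: "\<alpha> \<union> \<beta> \<in> deletion K F" if \<alpha>: "\<alpha> \<subset> F" and \<beta>: "\<beta> \<in> link K F" for \<alpha> \<beta>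
  proof -
    have "\<alpha> \<union> \<beta> \<in> K"
      using diamond_stage_subset_closed[of "F \<union> \<beta>" d T i "\<alpha> \<union> \<beta>"] \<alpha> \<beta> by (auto simp: link_def K_def)
    then show ?thesis using \<alpha> \<beta> by (auto simp: deletion_def link_def)
  qed
  have "\<tau> \<in> stellar_subdivision K F (New i) \<longleftrightarrow>
      \<tau> \<in> deletion K F \<or> (\<exists>\<alpha> \<beta>. \<alpha> \<subset> F \<and> \<beta> \<in> link K F \<and> \<tau> = insert (New i) (\<alpha> \<union> \<beta>))" for \<tau>
  proof -
    have "\<tau> \<in> join (full_simplex {New i}) (join (simplex_boundary F) (link K F)) \<longleftrightarrow>
        (\<exists>\<alpha> \<beta>. \<alpha> \<subset> F \<and> \<beta> \<in> link K F \<and> (\<tau> = \<alpha> \<union> \<beta> \<or> \<tau> = insert (New i) (\<alpha> \<union> \<beta>)))"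
    proof -
      have "\<tau> \<in> join (full_simplex {New i}) M \<longleftrightarrow> (\<exists>\<rho>\<in>M. \<tau> = \<rho> \<or> \<tau> = insert (New i) \<rho>)" for M
        unfolding join_def full_simplex_def by (auto simp: subset_singleton_iff)
      moreover have "\<alpha> \<in> simplex_boundary F \<longleftrightarrow> \<alpha> \<subset> F" for \<alpha>
        by (auto simp: simplex_boundary_def full_simplex_def)
      ultimately show ?thesis unfolding join_def[of "simplex_boundary F"] by (simp, blast)
    qed
    then show ?thesis unfolding stellar_subdivision_def Un_iff using low by metis
  qed
  moreover have "New i \<in> insert (New i) \<tau>" for \<tau> :: "vertex set" by simp
  ultimately have "\<tau> \<in> stellar_subdivision K F (New i) \<longleftrightarrow> \<tau> \<in> diamond_stage d T (Suc i)" for \<tau>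
    using old new star by metis
  then have "stellar_subdivision K F (New i) = diamond_stage d T (Suc i)" by blast
  then show ?thesis using step by (simp add: K_def)
qed

lemma diamond_omitting:
  assumes "T \<subseteq> {..d+1}"
  shows "diamond d (omitting (Old ` {..d+1}) (Old ` T)) = diamond_stage d T (Suc d)"
proof -
  have "fold (diamond_step d) [0..<i] (diamond_stage d T 0) = diamond_stage d T i" if "i \<le> Suc d" for i
    using that by (induction i) (auto simp: diamond_step_stage[OF assms])
  from this[of "Suc d"] show ?thesis
    by (simp add: diamond_def diamond_stage_0[OF assms])
qed

section \<open>Isomorphism classes\<close>

lemma isomorphic_complexes_iff:
  "isomorphic_complexes K L \<longleftrightarrow> (\<exists>f. inj_on f (\<Union>K) \<and> (`) f ` K = L)"
  unfolding isomorphic_complexes_def bij_betw_def by (auto simp: image_UN)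

lemma isomorphic_complexes_refl: "isomorphic_complexes K K"
  unfolding isomorphic_complexes_iff by (intro exI[of _ id]) auto

lemma isomorphic_complexes_sym:
  assumes "isomorphic_complexes K L" shows "isomorphic_complexes L K"
proof -
  obtain f where f: "bij_betw f (\<Union>K) (\<Union>L)" "(`) f ` K = L"
    using assms by (auto simp: isomorphic_complexes_def)
  let ?g = "inv_into (\<Union>K) f"
  have "?g ` f ` \<sigma> = \<sigma>" if "\<sigma> \<in> K" for \<sigma>
    using that f(1) by (intro inv_into_image_cancel) (auto simp: bij_betw_def)
  then have "(`) ?g ` L = K" unfolding f(2)[symmetric] by (auto simp: image_image)
  then show ?thesis using bij_betw_inv_into[OF f(1)] unfolding isomorphic_complexes_def by blast
qed

lemma isomorphic_complexes_trans:
  assumes "isomorphic_complexes K L" "isomorphic_complexes L M" shows "isomorphic_complexes K M"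
proof -
  obtain f where f: "bij_betw f (\<Union>K) (\<Union>L)" "(`) f ` K = L"
    using assms by (auto simp: isomorphic_complexes_def)
  obtain g where g: "bij_betw g (\<Union>L) (\<Union>M)" "(`) g ` L = M"
    using assms by (auto simp: isomorphic_complexes_def)
  have "(`) (g \<circ> f) ` K = M" using f(2) g(2) by (auto simp: image_comp)
  then show ?thesis using bij_betw_trans[OF f(1) g(1)] unfolding isomorphic_complexes_def by blast
qed

lemma equiv_same_flip: "equiv (removed_complexes d) (same_flip d)"
  by (intro equivI refl_onI symI transI)
    (auto simp: same_flip_def intro: isomorphic_complexes_refl isomorphic_complexes_sym isomorphic_complexes_trans)

lemma isomorphic_complexes_card_faces:
  assumes "isomorphic_complexes K L"
  shows "card {\<sigma>\<in>K. card \<sigma> = n} = card {\<sigma>\<in>L. card \<sigma> = n}"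
proof -
  obtain f where f: "inj_on f (\<Union>K)" "(`) f ` K = L"
    using assms by (auto simp: isomorphic_complexes_iff)
  have c: "card (f ` \<sigma>) = card \<sigma>" if "\<sigma> \<in> K" for \<sigma>
    using that f(1) by (intro card_image) (auto intro: inj_on_subset)
  have "{\<sigma>\<in>L. card \<sigma> = n} = (`) f ` {\<sigma>\<in>K. card \<sigma> = n}"
    using c unfolding f(2)[symmetric] by auto
  moreover have "inj_on ((`) f) {\<sigma>\<in>K. card \<sigma> = n}"
    by (rule inj_on_subset[OF inj_on_image_Pow[OF f(1)]]) auto
  ultimately show ?thesis by (simp add: card_image)
qed

section \<open>Facets of the diamonds and their number\<close>

definition cross_facet :: "nat \<Rightarrow> nat set \<Rightarrow> vertex set" where
  "cross_facet d N = Old ` ({..d} - N) \<union> New ` N"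

lemma inj_cross_facet: "inj (cross_facet d)"
proof (rule injI)
  fix M N assume "cross_facet d M = cross_facet d N"
  then have "{n. New n \<in> cross_facet d M} = {n. New n \<in> cross_facet d N}" by simp
  then show "M = N" by (auto simp: cross_facet_def)
qed

lemma card_cross_facet:
  assumes "N \<subseteq> {..d}"
  shows "card (cross_facet d N) = d + 1"
proof -
  have "card (cross_facet d N) = card ({..d} - N) + card N"
    unfolding cross_facet_def using assms finite_subset[OF assms]
    by (subst card_Un_disjoint) (auto simp: card_image inj_on_def)
  also have "\<dots> = d + 1" using assms card_mono[OF _ assms] finite_subset[OF assms] by (simp add: card_Diff_subset)
  finally show ?thesis .
qed

lemma inj_on_diff_left: "inj_on ((-) d) {..d::nat}"
  by (auto simp: inj_on_def)

text \<open>With \<open>d + 1\<close> vertices and no antipodal pair, a facet uses every pair. As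
  \<open>t\<close> \<le> \<open>d\<close>, missing \<open>Old t\<close> forces \<open>New t\<close>,
  so \<open>t\<close> is the least \<open>New\<close> index and the larger ones are free.\<close>

lemma diamond_stage_facets:
  assumes T: "T \<subseteq> {..d}"
  shows "{\<sigma> \<in> diamond_stage d T (Suc d). card \<sigma> = d + 1} =
    (\<Union>t\<in>T. (\<lambda>N. cross_facet d (insert t N)) ` Pow {t<..d})"
proof (intro set_eqI iffI)
  fix \<sigma> assume "\<sigma> \<in> {\<sigma> \<in> diamond_stage d T (Suc d). card \<sigma> = d + 1}"
  then have c: "card \<sigma> = d + 1" and s: "\<sigma> \<in> diamond_stage d T (Suc d)" by auto
  then obtain t where t: "t \<in> T" "Old t \<notin> \<sigma>" "\<forall>n<t. New n \<notin> \<sigma>"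
    and sub: "\<sigma> \<subseteq> Old ` {..d+1} \<union> New ` {..<Suc d}" and anti: "\<not> (Old n \<in> \<sigma> \<and> New n \<in> \<sigma>)"
    and l: "Old (Suc d) \<notin> \<sigma>" for n
    unfolding diamond_stage_def by auto
  define N where "N = {n. New n \<in> \<sigma>}"
  have N: "N \<subseteq> {..d}" using sub by (auto simp: N_def)
  have "\<sigma> \<subseteq> cross_facet d N"
  proof
    fix x assume "x \<in> \<sigma>"
    then show "x \<in> cross_facet d N" using sub l anti
      by (cases x) (auto simp: cross_facet_def N_def image_iff le_Suc_eq)
  qed
  then have eq: "\<sigma> = cross_facet d N"
    using card_cross_facet[OF N] c by (intro card_subset_eq) (auto intro: card_ge_0_finite)
  have "t \<in> N" using t T unfolding eq by (auto simp: cross_facet_def)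
  moreover have "N - {t} \<subseteq> {t<..d}"
    using N t(3) by (auto simp: N_def order_less_le)
  ultimately show "\<sigma> \<in> (\<Union>t\<in>T. (\<lambda>N. cross_facet d (insert t N)) ` Pow {t<..d})"
    using t(1) eq by (intro UN_I[of t] image_eqI[of _ _ "N - {t}"]) (auto simp: insert_absorb)
next
  fix \<sigma> assume "\<sigma> \<in> (\<Union>t\<in>T. (\<lambda>N. cross_facet d (insert t N)) ` Pow {t<..d})"
  then obtain t N where t: "t \<in> T" and N: "N \<subseteq> {t<..d}" and \<sigma>: "\<sigma> = cross_facet d (insert t N)"
    by auto
  have "card \<sigma> = d + 1" unfolding \<sigma> using t N T by (intro card_cross_facet) auto
  moreover have "\<sigma> \<in> diamond_stage d T (Suc d)"
    unfolding \<sigma> diamond_stage_def cross_facet_def using t N T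
    by (auto intro!: bexI[of _ t])
  ultimately show "\<sigma> \<in> {\<sigma> \<in> diamond_stage d T (Suc d). card \<sigma> = d + 1}" by simp
qed

text \<open>The families for different \<open>t\<close> are disjoint, since \<open>t\<close> is the
  least element of \<open>insert t N\<close>. Family \<open>t\<close> has \<open>2 ^ (d - t)\<close>
  members, so the binary digits 1 of the count sit at the positions \<open>d - t\<close>.\<close>

lemma card_diamond_stage_facets:
  assumes T: "T \<subseteq> {..d}"
  shows "card {\<sigma> \<in> diamond_stage d T (Suc d). card \<sigma> = d + 1} = set_encode ((\<lambda>t. d - t) ` T)"
proof -
  have inj: "inj_on (\<lambda>N. cross_facet d (insert t N)) (Pow {t<..d})" for t
  proof (rule inj_onI)
    fix M N assume "M \<in> Pow {t<..d}" "N \<in> Pow {t<..d}"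
      and "cross_facet d (insert t M) = cross_facet d (insert t N)"
    then have "insert t M = insert t N" "t \<notin> M" "t \<notin> N" using injD[OF inj_cross_facet] by auto
    then show "M = N" by (metis insert_ident)
  qed
  have "card (\<Union>t\<in>T. (\<lambda>N. cross_facet d (insert t N)) ` Pow {t<..d}) =
      (\<Sum>t\<in>T. card ((\<lambda>N. cross_facet d (insert t N)) ` Pow {t<..d}))"
  proof (rule card_UN_disjoint)
    show "finite T" using T by (rule finite_subset) simp
    show "\<forall>i\<in>T. \<forall>j\<in>T. i \<noteq> j \<longrightarrow> (\<lambda>N. cross_facet d (insert i N)) ` Pow {i<..d} \<inter>
         (\<lambda>N. cross_facet d (insert j N)) ` Pow {j<..d} = {}"
    proof (intro ballI impI equals0I)
      fix i j \<sigma> assume "i \<noteq> j" and "\<sigma> \<in> (\<lambda>N. cross_facet d (insert i N)) ` Pow {i<..d} \<inter>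
         (\<lambda>N. cross_facet d (insert j N)) ` Pow {j<..d}"
      then obtain M N where MN: "M \<subseteq> {i<..d}" "N \<subseteq> {j<..d}"
        and "cross_facet d (insert i M) = cross_facet d (insert j N)"
        by (elim IntE imageE) simp
      then have "insert i M = insert j N" by (intro injD[OF inj_cross_facet])
      then have "i \<in> insert j N" "j \<in> insert i M" by auto
      then have "j < i" "i < j" using \<open>i \<noteq> j\<close> MN by auto
      then show False by simp
    qed
  qed auto
  also have "\<dots> = (\<Sum>t\<in>T. 2 ^ (d - t))" by (simp add: card_image[OF inj] card_Pow)
  also have "\<dots> = set_encode ((\<lambda>t. d - t) ` T)"
    proof -
    have "inj_on ((-) d) T" using T by (intro inj_on_subset[OF inj_on_diff_left]) auto
    then show ?thesis by (simp add: set_encode_def sum.reindex)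
  qed
  finally show ?thesis unfolding diamond_stage_facets[OF T] .
qed

text \<open>Equal facet numbers are equal binary codes; the truncated subtraction
  \<open>d - t\<close> is injective because both sets lie in \<open>{..d}\<close>.\<close>

lemma isomorphic_diamond_stage_imp_eq:
  assumes "isomorphic_complexes (diamond_stage d S (Suc d)) (diamond_stage d T (Suc d))"
    and S: "S \<subseteq> {..d}" and T: "T \<subseteq> {..d}"
  shows "S = T"
proof -
  have "set_encode ((\<lambda>t. d - t) ` S) = set_encode ((\<lambda>t. d - t) ` T)"
    using isomorphic_complexes_card_faces[OF assms(1), of "d + 1"]
    by (simp only: card_diamond_stage_facets S T)
  then have "(\<lambda>t. d - t) ` S = (\<lambda>t. d - t) ` T"
    using S T by (subst (asm) set_encode_eq) (auto intro: finite_subset)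
  then show ?thesis using inj_on_image_eq_iff[OF inj_on_diff_left S T] by simp
qed

text \<open>Exchanging \<open>Old j\<close> with \<open>New j\<close>, where \<open>j\<close> is the largest index missing from \<open>T\<close>, trades the
  facets opposite to \<open>j + 1, \<dots>, d + 1\<close> for the one opposite to \<open>j\<close>.\<close>

lemma diamond_stage_isomorphic_reduced:
  assumes T: "T \<subseteq> {..d+1}" "T \<noteq> {}" "T \<noteq> {..d+1}"
  shows "\<exists>S. S \<noteq> {} \<and> S \<subseteq> {..d} \<and>
    isomorphic_complexes (diamond_stage d T (Suc d)) (diamond_stage d S (Suc d))"
proof (cases "d + 1 \<in> T")
  case False
  then have "T \<subseteq> {..d}" using T(1) by (auto simp: subset_iff le_Suc_eq)
  then show ?thesis using T(2) isomorphic_complexes_refl by blast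
next
  case True
  \<comment> \<open>The maximum exists because \<open>T\<close> is not all of
    \<open>{..d+1}\<close>. Since \<open>d + 1\<close> is in \<open>T\<close>, it is at most
    \<open>d\<close>, so \<open>Old j\<close> does have an antipode.\<close>
  define j where "j = Max ({..d+1} - T)"
  have "{..d+1} - T \<noteq> {}" using T by auto
  then have j: "j \<in> {..d+1} - T" unfolding j_def by (intro Max_in) auto
  then have jd: "j \<le> d" using True by (cases "j = d + 1") auto
  have jmax: "n \<in> T" if "j < n" "n \<le> d + 1" for n
  proof (rule ccontr)
    assume "n \<notin> T"
    then have "n \<le> j" unfolding j_def using that by (intro Max_ge) auto
    then show False using that by simp
  qed
  define S where "S = insert j {t \<in> T. t < j}"
  define f where "f = (\<lambda>v. if v = Old j then New j else if v = New j then Old j else v)"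
  have ff: "f (f v) = v" for v by (auto simp: f_def)
  have fim: "v \<in> f ` \<sigma> \<longleftrightarrow> f v \<in> \<sigma>" for v \<sigma> using ff by (metis image_iff)
  have fimf: "f ` f ` \<sigma> = \<sigma>" for \<sigma> by (simp add: image_image ff)
  \<comment> \<open>\<open>C\<close> is the boundary of the whole cross-polytope, and
    \<open>P\<close> selects the subcomplex belonging to an index set.\<close>
  define C where "C = {\<sigma>. \<sigma> \<subseteq> Old ` {..d} \<union> New ` {..d} \<and> (\<forall>n. \<not> (Old n \<in> \<sigma> \<and> New n \<in> \<sigma>))}"
  define P where "P = (\<lambda>T \<sigma>. \<exists>t\<in>T. Old t \<notin> \<sigma> \<and> (\<forall>n<t. New n \<notin> \<sigma>))"
  have stage: "diamond_stage d T (Suc d) = {\<sigma>\<in>C. P T \<sigma>}" for T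
  proof -
    have "\<sigma> \<subseteq> Old ` {..d+1} \<union> New ` {..<Suc d} \<and> (\<exists>n\<in>{Suc d..d+1}. Old n \<notin> \<sigma>) \<longleftrightarrow>
       \<sigma> \<subseteq> Old ` {..d} \<union> New ` {..d}" for \<sigma>
      by (auto simp: atMost_Suc lessThan_Suc_atMost)
    then show ?thesis unfolding diamond_stage_def C_def P_def by blast
  qed
  have fC: "f ` \<sigma> \<in> C" if "\<sigma> \<in> C" for \<sigma>
  proof -
    have "f ` \<sigma> \<subseteq> Old ` {..d} \<union> New ` {..d}" using that jd by (auto simp: C_def f_def)
    moreover have "\<not> (Old n \<in> f ` \<sigma> \<and> New n \<in> f ` \<sigma>)" for n
      using that unfolding fim by (cases "n = j") (auto simp: C_def f_def)
    ultimately show ?thesis by (simp add: C_def)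
  qed
  have PP: "P S (f ` \<sigma>) \<longleftrightarrow> P T \<sigma>" if \<sigma>: "\<sigma> \<in> C" for \<sigma>
  proof -
    have "P T \<sigma> \<longleftrightarrow> P {t \<in> T. t < j} \<sigma> \<or> P {t \<in> T. j < t} \<sigma>"
    proof -
      have "t < j \<or> j < t" if "t \<in> T" for t using that j by (cases "t = j") auto
      then show ?thesis unfolding P_def by blast
    qed
    moreover have "P {t \<in> T. j < t} \<sigma> \<longleftrightarrow> (\<forall>n\<le>j. New n \<notin> \<sigma>)"
    proof
      assume "P {t \<in> T. j < t} \<sigma>" then show "\<forall>n\<le>j. New n \<notin> \<sigma>" by (auto simp: P_def)
    next
      assume a: "\<forall>n\<le>j. New n \<notin> \<sigma>"
      \<comment> \<open>The least \<open>New\<close> index of \<open>\<sigma>\<close>, or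
        \<open>d + 1\<close> if there is none. It exceeds \<open>j\<close>, hence lies in
        \<open>T\<close>, and \<open>Old t\<close> is missing: as an antipode in the first case, by
        membership in \<open>C\<close> in the second.\<close>
      define t where "t = (LEAST n. n = d + 1 \<or> New n \<in> \<sigma>)"
      have t: "t = d + 1 \<or> New t \<in> \<sigma>" unfolding t_def by (rule LeastI[of _ "d + 1"]) simp
      have lt: "New n \<notin> \<sigma>" if "n < t" for n using not_less_Least[of n] that unfolding t_def by blast
      have td: "t \<le> d + 1" unfolding t_def by (rule Least_le) simp
      have jt: "j < t" using t a jd by (metis Suc_eq_plus1 le_imp_less_Suc not_le)
      have "Old t \<notin> \<sigma>" using t \<sigma> by (auto simp: C_def)
      then show "P {t \<in> T. j < t} \<sigma>" unfolding P_def using lt jt jmax[OF jt td] by blast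
    qed
    moreover have "P S (f ` \<sigma>) \<longleftrightarrow> P {t \<in> T. t < j} \<sigma> \<or> (\<forall>n\<le>j. New n \<notin> \<sigma>)"
    proof -
      have "P S (f ` \<sigma>) \<longleftrightarrow> P {j} (f ` \<sigma>) \<or> P {t \<in> T. t < j} (f ` \<sigma>)"
        unfolding P_def S_def by blast
      moreover have "P {j} (f ` \<sigma>) \<longleftrightarrow> New j \<notin> \<sigma> \<and> (\<forall>n<j. New n \<notin> \<sigma>)"
        unfolding P_def fim by (simp add: f_def)
      \<comment> \<open>For \<open>t < j\<close> the condition involves only indices below
        \<open>j\<close>, which \<open>f\<close> fixes.\<close>
      moreover have "P {t \<in> T. t < j} (f ` \<sigma>) \<longleftrightarrow> P {t \<in> T. t < j} \<sigma>"
        unfolding P_def fim by (intro bex_cong refl) (simp add: f_def)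
      ultimately show ?thesis by (auto simp: le_less)
    qed
    ultimately show ?thesis by simp
  qed
  have "(`) f ` {\<sigma>\<in>C. P T \<sigma>} = {\<sigma>\<in>C. P S \<sigma>}"
  proof (intro set_eqI iffI)
    fix \<tau> assume "\<tau> \<in> {\<sigma>\<in>C. P S \<sigma>}"
    then have "f ` \<tau> \<in> {\<sigma>\<in>C. P T \<sigma>}" using PP[of "f ` \<tau>"] fC fimf by auto
    then show "\<tau> \<in> (`) f ` {\<sigma>\<in>C. P T \<sigma>}" using fimf[of \<tau>] by (metis image_eqI)
  qed (use fC PP in auto)
  moreover have "inj f" using ff by (metis injI)
  ultimately have "isomorphic_complexes (diamond_stage d T (Suc d)) (diamond_stage d S (Suc d))"
    unfolding isomorphic_complexes_iff stage by (meson inj_on_subset subset_UNIV)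
  moreover have "S \<noteq> {}" "S \<subseteq> {..d}" using jd by (auto simp: S_def)
  ultimately show ?thesis by blast
qed

section \<open>Removed complexes as final stages, and the count of classes\<close>

lemma boundary_sigma_eq: "boundary_sigma d = simplex_boundary (Old ` {..d+1})"
  by (simp add: boundary_sigma_def atLeast0AtMost)

lemma removed_complexes_diamond_stage:
  assumes "D \<in> removed_complexes d"
  obtains T where "T \<subseteq> {..d+1}" "T \<noteq> {}" "T \<noteq> {..d+1}" "D = diamond_stage d T (Suc d)"
proof -
  let ?V = "Old ` {..d+1}"
  obtain \<Gamma> where D: "D = diamond d \<Gamma>" and \<Gamma>: "simplicial_complex \<Gamma>" "\<Gamma> \<subset> simplex_boundary ?V" "pure_dim d \<Gamma>"
    using assms by (auto simp: removed_complexes_def flip_balls_def boundary_sigma_eq)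
  define T where "T = {n. n \<le> d + 1 \<and> ?V - {Old n} \<in> \<Gamma>}"
  have OT: "{v \<in> ?V. ?V - {v} \<in> \<Gamma>} = Old ` T" by (auto simp: T_def)
  have "card ?V = d + 2" by (simp add: card_image inj_on_def)
  from pure_subcomplex_boundary[OF \<Gamma>(1) psubset_imp_subset[OF \<Gamma>(2)] \<Gamma>(3) _ this, unfolded OT]
  have eq: "\<Gamma> = omitting ?V (Old ` T)" and ne: "T \<noteq> {}" by auto
  have "T \<subseteq> {..d+1}" by (auto simp: T_def)
  \<comment> \<open>Containing all facets would make \<open>\<Gamma>\<close> the entire
    boundary.\<close>
  moreover have "T \<noteq> {..d+1}"
    using \<Gamma>(2) eq by (auto simp: omitting_def simplex_boundary_def full_simplex_def)
  ultimately show ?thesis using that ne diamond_omitting D eq by blast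
qed

lemma diamond_stage_removed:
  assumes T: "T \<subseteq> {..d}" "T \<noteq> {}"
  shows "diamond_stage d T (Suc d) \<in> removed_complexes d"
proof -
  let ?V = "Old ` {..d+1}" and ?\<Gamma> = "omitting (Old ` {..d+1}) (Old ` T)"
  have V: "finite ?V" "card ?V = d + 2" by (auto simp: card_image inj_on_def)
  have TV: "Old ` T \<subset> ?V"
  proof -
    have "Old (d + 1) \<notin> Old ` T" "Old ` T \<subseteq> ?V" using T by auto
    then show ?thesis by blast
  qed
  \<comment> \<open>As \<open>d + 1\<close> is not in \<open>T\<close>, the facet opposite to it
    witnesses that the inclusion is proper.\<close>
  have "?V - {Old (d + 1)} \<in> simplex_boundary ?V - ?\<Gamma>"
    using T by (auto simp: simplex_boundary_def full_simplex_def omitting_def)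
  moreover have "?\<Gamma> \<subseteq> simplex_boundary ?V"
    using TV by (auto simp: simplex_boundary_def full_simplex_def omitting_def)
  ultimately have "?\<Gamma> \<subset> boundary_sigma d" unfolding boundary_sigma_eq by blast
  then have "?\<Gamma> \<in> flip_balls d" unfolding flip_balls_def
    using simplicial_complex_omitting[OF V(1)] pure_dim_omitting[OF V psubset_imp_subset[OF TV]]
      simplicial_ball_omitting[OF V TV] T by blast
  moreover have "diamond d ?\<Gamma> = diamond_stage d T (Suc d)"
    using T by (intro diamond_omitting) auto
  ultimately show ?thesis unfolding removed_complexes_def by (metis image_eqI)
qed

theorem theorem4p3:
  fixes d :: nat
  assumes "d \<ge> 1"
  shows "card (removed_complexes d // same_flip d) = 2 ^ (d + 1) - 1"
proof -
  define q where "q T = same_flip d `` {diamond_stage d T (Suc d)}" for T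
  \<comment> \<open>Index set of representatives: the facet counts separate their classes, and the
    antipodal exchange shows that every class is reached.\<close>
  define \<T> where "\<T> = Pow {..d} - {{}}"
  note rem = diamond_stage_removed and class_eq = eq_equiv_class_iff[OF equiv_same_flip]
  have "inj_on q \<T>"
  proof (rule inj_onI)
    fix S T assume "S \<in> \<T>" "T \<in> \<T>" "q S = q T"
    then have "(diamond_stage d S (Suc d), diamond_stage d T (Suc d)) \<in> same_flip d"
      unfolding q_def \<T>_def by (subst class_eq[symmetric]) (auto intro: rem)
    then show "S = T"
      using isomorphic_diamond_stage_imp_eq \<open>S \<in> \<T>\<close> \<open>T \<in> \<T>\<close> by (auto simp: same_flip_def \<T>_def)
  qed
  moreover have "q ` \<T> = removed_complexes d // same_flip d"
  proof
    show "q ` \<T> \<subseteq> removed_complexes d // same_flip d"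
      using rem by (auto simp: q_def \<T>_def intro!: quotientI)
    show "removed_complexes d // same_flip d \<subseteq> q ` \<T>"
    proof
      fix A assume "A \<in> removed_complexes d // same_flip d"
      then obtain D where D: "D \<in> removed_complexes d" "A = same_flip d `` {D}" by (rule quotientE)
      obtain S where S: "S \<noteq> {}" "S \<subseteq> {..d}" "isomorphic_complexes D (diamond_stage d S (Suc d))"
        using D(1) by (metis removed_complexes_diamond_stage diamond_stage_isomorphic_reduced)
      then have "(D, diamond_stage d S (Suc d)) \<in> same_flip d"
        using D rem by (auto simp: same_flip_def)
      then have "A = q S" unfolding q_def D(2) by (rule equiv_class_eq[OF equiv_same_flip])
      then show "A \<in> q ` \<T>" using S by (auto simp: \<T>_def)
    qed
  qed
  moreover have "card \<T> = 2 ^ (d + 1) - 1" by (simp add: \<T>_def card_Pow)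
  ultimately show ?thesis by (metis card_image)
qed

end
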